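(* Let $M$ be a finite set of prime numbers, let $p_j\in M$, and put $L=\dfrac{\prod_{p_i\in M}p_i}{p_j-1}$. Then for every integer $K$ the interval $\bigl((K-1)L,\;KL\bigr]$, which has length $L$, contains exactly $$\prod_{p_i\in M,\ p_i\neq p_j}(p_i-1)$$ $M$-primes.
   Context: For a set $M$ of prime numbers, an $M$-prime is an integer (positive, negative or zero) not divisible by any of the primes in $M$. An empty product equals $1$. *)

theory Defs
  imports "HOL-Analysis.Analysis" "HOL-Computational_Algebra.Primes"
begin

definition M_prime :: "nat set \<Rightarrow> int \<Rightarrow> bool" where
  "M_prime M n \<longleftrightarrow> (\<forall>p\<in>M. \<not> int p dvd n)"

end

(* Deleting from the M-primes in an interval the multiples of a further prime p removes p times the
   M-primes of the interval shrunk by p. Starting from M = {q}, where floor (b q / (q - 1)) =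
   b + floor (b / (q - 1)) makes the count exact, one can thus add the other primes one by one,
   provided the end points are kept in the form a P q / (q - 1) with P the product of these primes. *)
theory Submission
  imports Defs
begin

text \<open>A prime outside \<open>S\<close> is divisible by no member of \<open>S\<close>, so by
  Euclid's lemma the factor \<open>p\<close> affects none of the divisibility conditions.\<close>

lemma M_prime_mult_prime_iff:
  assumes "\<And>x. x \<in> S \<Longrightarrow> prime x" "prime p" "p \<notin> S"
  shows "M_prime S (int p * n) \<longleftrightarrow> M_prime S n"
proof -
  have "int x dvd int p * n \<longleftrightarrow> int x dvd n" if "x \<in> S" for x
  proof -
    have "\<not> int x dvd int p"
      using that assms primes_dvd_imp_eq[of x p] by auto
    moreover have "prime (int x)"
      using that assms by simp
    ultimately show ?thesis
      by (simp add: prime_dvd_mult_iff)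
  qed
  then show ?thesis
    by (simp add: M_prime_def)
qed

text \<open>The interval \<open>(a / r, b / r]\<close> is expressed without division.\<close>

definition M_primes_between :: "nat set \<Rightarrow> int \<Rightarrow> int \<Rightarrow> int \<Rightarrow> int set" where
  "M_primes_between S r a b = {n. M_prime S n \<and> a < n * r \<and> n * r \<le> b}"

lemma mult_le_iff_le_div:
  fixes r :: int
  assumes "r > 0"
  shows "n * r \<le> b \<longleftrightarrow> n \<le> b div r"
proof
  assume "n * r \<le> b"
  then have "n * r div r \<le> b div r"
    using assms by (intro zdiv_mono1)
  then show "n \<le> b div r"
    using assms by simp
next
  assume "n \<le> b div r"
  then have "n * r \<le> b div r * r"
    using assms by (intro mult_right_mono) auto
  also have "\<dots> \<le> b"
    using assms pos_mod_sign[OF assms, of b] div_mult_mod_eq[of b r] by linarith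
  finally show "n * r \<le> b" .
qed

lemma less_mult_iff_div_less:
  fixes r :: int
  assumes "r > 0"
  shows "a < n * r \<longleftrightarrow> a div r < n"
  using mult_le_iff_le_div[OF assms, of n a] by linarith

lemma finite_M_primes_between:
  assumes "r > 0"
  shows "finite (M_primes_between S r a b)"
  by (rule finite_subset[of _ "{a div r<..b div r}"])
    (auto simp: M_primes_between_def less_mult_iff_div_less mult_le_iff_le_div assms)

text \<open>The numbers lost on adding \<open>p\<close> are the products \<open>p * k\<close> with
  \<open>k\<close> counted between \<open>a\<close> and \<open>b\<close>. Writing the end points as
  multiples of \<open>p\<close> lets this factor cancel without any rounding.\<close>

lemma card_M_primes_between_insert:
  assumes "r > 0" "\<And>x. x \<in> S \<Longrightarrow> prime x" "prime p" "p \<notin> S"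
  shows "int (card (M_primes_between (insert p S) r (int p * a) (int p * b))) =
    int (card (M_primes_between S r (int p * a) (int p * b))) - int (card (M_primes_between S r a b))"
proof -
  let ?N = "M_primes_between S r (int p * a) (int p * b)"
  let ?D = "(*) (int p) ` M_primes_between S r a b"
  have p: "int p > 0"
    using assms(3) prime_gt_0_nat by simp
  have in_shrunk: "int p * k \<in> ?N \<longleftrightarrow> k \<in> M_primes_between S r a b" for k
    using p M_prime_mult_prime_iff[OF assms(2-4)]
    by (simp add: M_primes_between_def mult.assoc)
  have "M_primes_between (insert p S) r (int p * a) (int p * b) = ?N - {n. int p dvd n}"
    by (auto simp: M_primes_between_def M_prime_def)
  also have "\<dots> = ?N - ?D"
    using in_shrunk by (auto simp: dvd_def image_iff)
  finally have eq: "M_primes_between (insert p S) r (int p * a) (int p * b) = ?N - ?D" .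
  have "?D \<subseteq> ?N"
    using in_shrunk by auto
  moreover have "finite ?N"
    by (rule finite_M_primes_between[OF assms(1)])
  moreover have "card ?D = card (M_primes_between S r a b)"
    using p by (intro card_image) (auto simp: inj_on_def)
  \<comment> \<open>The inclusion \<open>?D \<subseteq> ?N\<close> also ensures that the
    natural-number difference of the cardinalities is not truncated.\<close>
  ultimately show ?thesis
    unfolding eq by (metis card_Diff_subset card_mono finite_subset of_nat_diff)
qed

text \<open>All integers in the interval number \<open>b - a + (b div r - a div r)\<close>, and the
  multiples of \<open>q\<close> among them number \<open>b div r - a div r\<close>, so the floor
  terms cancel.\<close>

lemma card_M_primes_between_singleton:
  assumes "q \<ge> 2" "a \<le> b"
  shows "int (card (M_primes_between {q} (int q - 1) (a * int q) (b * int q))) = b - a"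
proof -
  define r where "r = int q - 1"
  have r: "r > 0" and q: "int q = r + 1"
    using assms(1) by (auto simp: r_def)
  have div: "(x * int q) div r = x + x div r" for x
    using r by (simp add: q distrib_left)
  have mult: "x < k * r \<longleftrightarrow> x * int q < int q * k * r"
    "k * r \<le> x \<longleftrightarrow> int q * k * r \<le> x * int q" for x k
    using r by (simp_all add: q mult.commute[of x] mult.assoc)
  let ?I = "{a + a div r<..b + b div r}"
  let ?D = "(*) (int q) ` {a div r<..b div r}"
  have I: "a * int q < n * r \<and> n * r \<le> b * int q \<longleftrightarrow> n \<in> ?I" for n
    using r by (simp add: less_mult_iff_div_less mult_le_iff_le_div div)
  have D: "int q * k \<in> ?I \<longleftrightarrow> k \<in> {a div r<..b div r}" for k
    using I[of "int q * k"] r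
    by (simp add: mult[symmetric] less_mult_iff_div_less mult_le_iff_le_div)
  have "M_primes_between {q} r (a * int q) (b * int q) = ?I - {n. int q dvd n}"
    unfolding M_primes_between_def M_prime_def using I by blast
  also have "\<dots> = ?I - ?D"
    unfolding dvd_def image_def using D by blast
  finally have eq: "M_primes_between {q} r (a * int q) (b * int q) = ?I - ?D" .
  have "?D \<subseteq> ?I"
    using D by blast
  moreover have "card ?D = card {a div r<..b div r}"
    using r q by (intro card_image) (auto simp: inj_on_def)
  \<comment> \<open>The size of an integer interval is \<open>nat\<close> of a difference, so the
    cancellation needs this difference to be nonnegative.\<close>
  moreover have "a div r \<le> b div r"
    using assms(2) r by (simp add: zdiv_mono1)
  ultimately show ?thesis
    using assms(2) unfolding r_def[symmetric] eq
    by (simp add: card_Diff_subset finite_subset)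
qed

text \<open>Each new prime \<open>p\<close> turns the count \<open>b - a\<close> times a product
  into \<open>p * (b - a) - (b - a)\<close> times it, which yields the factor \<open>p - 1\<close>.
  The end points vary in the induction because the hypothesis is used for two intervals.\<close>

lemma card_M_primes_between:
  assumes "finite S" "\<And>p. p \<in> S \<Longrightarrow> prime p" "prime q" "q \<notin> S" "a \<le> b"
  shows "int (card (M_primes_between (insert q S) (int q - 1)
      (a * int (\<Prod>S) * int q) (b * int (\<Prod>S) * int q))) = (b - a) * int (\<Prod>p\<in>S. p - 1)"
  using assms
proof (induction S arbitrary: a b rule: finite_induct)
  case empty
  then show ?case
    using card_M_primes_between_singleton[of q a b] prime_ge_2_nat by simp
next
  case (insert p S)
  have r: "int q - 1 > 0"
    using prime_gt_1_nat[OF insert.prems(2)] by simp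
  \<comment> \<open>The bound lets the natural-number subtraction \<open>p - 1\<close> pass to the
    integers at the end.\<close>
  have p: "prime p" "p \<ge> 1"
    using insert.prems(1) prime_ge_1_nat[of p] by simp_all
  let ?e = "\<lambda>x. x * int (\<Prod>S) * int q"
  have "int (card (M_primes_between (insert p (insert q S)) (int q - 1) (int p * ?e a) (int p * ?e b)))
    = int (card (M_primes_between (insert q S) (int q - 1) (int p * ?e a) (int p * ?e b)))
      - int (card (M_primes_between (insert q S) (int q - 1) (?e a) (?e b)))"
    using insert.hyps insert.prems r p by (intro card_M_primes_between_insert) auto
  also have "int (card (M_primes_between (insert q S) (int q - 1) (?e a) (?e b)))
      = (b - a) * int (\<Prod>p\<in>S. p - 1)"
    using insert.prems by (intro insert.IH) auto
  \<comment> \<open>The factor \<open>p\<close> is absorbed into \<open>a\<close> and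
    \<open>b\<close>, so the hypothesis covers the longer interval too.\<close>
  also have "int (card (M_primes_between (insert q S) (int q - 1) (int p * ?e a) (int p * ?e b)))
      = (int p * b - int p * a) * int (\<Prod>p\<in>S. p - 1)"
    using insert.IH[of "int p * a" "int p * b"] insert.prems
    by (simp add: mult.assoc mult_left_mono)
  finally show ?case
    using insert.hyps p by (simp add: insert_commute algebra_simps of_nat_diff)
qed

theorem mainTheorem14:
  fixes M :: "nat set" and q :: nat and K :: int and L :: real
  assumes "finite M" and "\<And>p. p \<in> M \<Longrightarrow> prime p" and "q \<in> M"
    and "L = real (\<Prod>p\<in>M. p) / (real q - 1)"
  shows "measure lborel {(of_int K - 1) * L <.. of_int K * L} = L \<and>
    card {n :: int. M_prime M n \<and> of_int n \<in> {(of_int K - 1) * L <.. of_int K * L}}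
      = (\<Prod>p\<in>M - {q}. p - 1)"
proof
  have q: "prime q" "q \<ge> 2"
    using assms prime_ge_2_nat by auto
  then have r: "real q - 1 > 0"
    by simp
  \<comment> \<open>This puts the end points in order, so that the measure is their
    difference.\<close>
  have L: "L \<ge> 0"
    using r by (simp add: assms(4) del: of_nat_prod)
  then show "measure lborel {(of_int K - 1) * L <.. of_int K * L} = L"
    by (simp add: mult_right_mono algebra_simps)
  let ?P = "\<Prod>(M - {q})"
  have prod: "(\<Prod>p\<in>M. p) = ?P * q"
    using assms(1,3) by (simp add: prod.remove mult.commute)
  \<comment> \<open>Multiplying by the positive \<open>q - 1\<close> clears the denominator of
    \<open>L\<close> and leaves a comparison of integers.\<close>
  have lower: "real_of_int x * L < of_int n \<longleftrightarrow> x * int ?P * int q < n * (int q - 1)" for x n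
  proof -
    have "real_of_int x * L < of_int n \<longleftrightarrow>
      real_of_int x * real ?P * real q < of_int n * (real q - 1)"
      using r by (simp add: assms(4) prod divide_less_eq mult.assoc del: of_nat_prod)
    also have "\<dots> \<longleftrightarrow> real_of_int (x * int ?P * int q) < real_of_int (n * (int q - 1))"
      by (simp del: of_nat_prod)
    finally show ?thesis
      by (simp only: of_int_less_iff)
  qed
  have upper: "real_of_int n \<le> of_int x * L \<longleftrightarrow> n * (int q - 1) \<le> x * int ?P * int q" for x n
    using lower[of x n] by linarith
  have "{n :: int. M_prime M n \<and> of_int n \<in> {(of_int K - 1) * L <.. of_int K * L}}
    = M_primes_between (insert q (M - {q})) (int q - 1)
        ((K - 1) * int ?P * int q) (K * int ?P * int q)"
    using lower[of "K - 1"] upper[of _ K] assms(3)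
    by (simp add: M_primes_between_def insert_absorb del: of_nat_prod)
  \<comment> \<open>Here \<open>a = K - 1\<close> and \<open>b = K\<close>, so \<open>b - a\<close>
    is 1 and only the product remains.\<close>
  moreover have "int (card (M_primes_between (insert q (M - {q})) (int q - 1)
        ((K - 1) * int ?P * int q) (K * int ?P * int q)))
      = (K - (K - 1)) * int (\<Prod>p\<in>M - {q}. p - 1)"
    using assms q by (intro card_M_primes_between) auto
  ultimately show "card {n :: int. M_prime M n \<and> of_int n \<in> {(of_int K - 1) * L <.. of_int K * L}}
      = (\<Prod>p\<in>M - {q}. p - 1)"
    by (simp del: of_nat_prod)
qed

end
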